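(* Let $R\subseteq\mathbb{N}$ be a set of positive integers, let $r\geqslant 1$ be an integer, and let $R_1,\ldots,R_r$ be sets with $R=R_1\cup\cdots\cup R_r$. If $R$ is a set of nice recurrence, then there exists $1\leqslant i\leqslant r$ such that $R_i$ is a set of nice recurrence.
   Context: $\mathbb{N}$ denotes the set of positive integers. A measure preserving system $(X,\mu,T)$ consists of a probability measure space $(X,\mu)$ and a measurable function $T:X\to X$ (not assumed invertible) satisfying $\mu(T^{-1}A)=\mu(A)$ for all measurable $A\subseteq X$. For $n\geqslant 0$, $T^n$ is the $n$-fold composition of $T$ with itself, and $T^{-n}A:=(T^n)^{-1}(A)=\{x\in X: T^n(x)\in A\}$. A set of positive integers $R$ is called a set of nice recurrence if for all measure preserving systems $(X,\mu,T)$, all measurable $A\subseteq X$, and all $\varepsilon>0$, there exists $n\in R$ such that $\mu(A\cap T^{-n}A)\geqslant \mu(A)^2-\varepsilon$. *)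

theory Defs
  imports "HOL-Probability.Probability"
begin

locale measure_preserving_system = prob_space M for M :: "'a measure" +
  fixes T :: "'a \<Rightarrow> 'a"
  assumes measurable_T: "T \<in> M \<rightarrow>\<^sub>M M"
    and measure_vimage_T: "\<And>A. A \<in> sets M \<Longrightarrow> measure M (T -` A \<inter> space M) = measure M A"

text \<open>Recurrence for all measure preserving systems whose points are taken from a given type.
  As \<^term>\<open>A\<close> is a subset of the space, so is the intersection below.\<close>

definition nice_recurrence_on :: "'a itself \<Rightarrow> nat set \<Rightarrow> bool" where
  "nice_recurrence_on _ R \<longleftrightarrow> R \<subseteq> {1..} \<and>
     (\<forall>(M :: 'a measure) T A \<epsilon>. measure_preserving_system M T \<longrightarrow> A \<in> sets M \<longrightarrow> \<epsilon> > 0 \<longrightarrow>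
        (\<exists>n\<in>R. measure M (A \<inter> (T ^^ n) -` A) \<ge> (measure M A)\<^sup>2 - \<epsilon>))"

text \<open>HOL cannot quantify over all types inside a formula, so one type of points has to be fixed.
  The spaces, sigma-algebras, measures and maps on that type remain arbitrary. The lemma
  \<open>nice_recurrence_all_types\<close> below shows that recurrence for the type
  \<^typ>\<open>nat \<Rightarrow> bool\<close> implies recurrence for systems over every type, so this choice loses
  no generality.\<close>

definition nice_recurrence :: "nat set \<Rightarrow> bool" where
  "nice_recurrence R \<longleftrightarrow> nice_recurrence_on TYPE(nat \<Rightarrow> bool) R"

text \<open>Coding a point by its itinerary with respect to \<^term>\<open>A\<close> maps any system onto a shift
  on \<^typ>\<open>nat \<Rightarrow> bool\<close> and preserves all the measures that occur in the definition.\<close>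

lemma nice_recurrence_all_types:
  assumes "nice_recurrence R"
  shows "nice_recurrence_on TYPE('a) R"
  unfolding nice_recurrence_on_def
proof (intro conjI allI impI)
  show "R \<subseteq> {1..}"
    using assms by (simp add: nice_recurrence_def nice_recurrence_on_def)
next
  fix M :: "'a measure" and T A and \<epsilon> :: real
  assume mps: "measure_preserving_system M T" and A: "A \<in> sets M" and \<epsilon>: "\<epsilon> > 0"
  interpret measure_preserving_system M T by (fact mps)
  define S :: "(nat \<Rightarrow> bool) measure" where "S = PiM UNIV (\<lambda>_. count_space UNIV)"
  define \<phi> where "\<phi> = (\<lambda>x k. (T ^^ k) x \<in> A)"
  define \<sigma> :: "(nat \<Rightarrow> bool) \<Rightarrow> nat \<Rightarrow> bool" where "\<sigma> = (\<lambda>f k. f (Suc k))"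
  define B where "B = {f :: nat \<Rightarrow> bool. f 0}"
  define N where "N = distr M S \<phi>"
  have space_S: "space S = UNIV"
    by (simp add: S_def space_PiM)
  have Tn: "T ^^ n \<in> M \<rightarrow>\<^sub>M M" for n
  proof (induction n)
    case (Suc n)
    show ?case
      using measurable_comp[OF Suc measurable_T] by (simp add: o_def)
  qed (simp add: id_def)
  have comp: "(\<lambda>f :: nat \<Rightarrow> bool. f k) \<in> S \<rightarrow>\<^sub>M count_space UNIV" for k
    unfolding S_def by (rule measurable_component_singleton) simp
  have mem_A: "(\<lambda>x. x \<in> A) \<in> M \<rightarrow>\<^sub>M count_space UNIV"
    using A by measurable
  have \<phi>: "\<phi> \<in> M \<rightarrow>\<^sub>M S"
    unfolding S_def \<phi>_def
  proof (rule measurable_PiM_single')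
    fix k :: nat
    show "(\<lambda>x. (T ^^ k) x \<in> A) \<in> M \<rightarrow>\<^sub>M count_space UNIV"
      by (rule measurable_compose[OF Tn mem_A])
  qed auto
  have \<sigma>: "\<sigma> \<in> S \<rightarrow>\<^sub>M S"
    unfolding \<sigma>_def using comp unfolding S_def by (intro measurable_PiM_single') auto
  have B: "B \<in> sets S"
    using measurable_sets[OF comp[of 0], of "{True}"] by (simp add: space_S vimage_def B_def)
  have \<phi>T: "\<phi> (T x) = \<sigma> (\<phi> x)" for x
    by (simp add: \<phi>_def \<sigma>_def funpow_swap1)
  have meas: "measure N C = measure M (\<phi> -` C \<inter> space M)" if "C \<in> sets S" for C
    unfolding N_def using \<phi> that by (rule measure_distr)
  have mpsN: "measure_preserving_system N \<sigma>"
  proof (intro measure_preserving_system.intro measure_preserving_system_axioms.intro)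
    show "prob_space N"
      unfolding N_def using \<phi> by (rule prob_space_distr)
    show "\<sigma> \<in> N \<rightarrow>\<^sub>M N"
      using \<sigma> by (simp add: N_def)
    fix C assume "C \<in> sets N"
    then have C: "C \<in> sets S" by (simp add: N_def)
    have "\<sigma> -` C \<in> sets S"
      using measurable_sets[OF \<sigma> C] by (simp add: space_S)
    then have "measure N (\<sigma> -` C) = measure M (\<phi> -` (\<sigma> -` C) \<inter> space M)"
      by (rule meas)
    also have "\<phi> -` (\<sigma> -` C) \<inter> space M = T -` (\<phi> -` C \<inter> space M) \<inter> space M"
      using measurable_space[OF measurable_T] by (auto simp: \<phi>T)
    also have "measure M \<dots> = measure M (\<phi> -` C \<inter> space M)"
      by (rule measure_vimage_T) (rule measurable_sets[OF \<phi> C])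
    also have "\<dots> = measure N C"
      by (simp add: meas C)
    finally show "measure N (\<sigma> -` C \<inter> space N) = measure N C"
      by (simp add: N_def space_S)
  qed
  have "\<exists>n\<in>R. measure N (B \<inter> (\<sigma> ^^ n) -` B) \<ge> (measure N B)\<^sup>2 - \<epsilon>"
    using assms mpsN B \<epsilon> unfolding nice_recurrence_def nice_recurrence_on_def
    by (simp add: N_def)
  then obtain n where n: "n \<in> R" "measure N (B \<inter> (\<sigma> ^^ n) -` B) \<ge> (measure N B)\<^sup>2 - \<epsilon>"
    by blast
  have \<sigma>n: "(\<sigma> ^^ n) f k = f (n + k)" for f k
    by (induction n arbitrary: k) (auto simp: \<sigma>_def)
  have Bn: "B \<inter> (\<sigma> ^^ n) -` B = B \<inter> (\<lambda>f. f n) -` {True} \<inter> space S"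
    by (auto simp: B_def \<sigma>n space_S)
  have "B \<inter> (\<sigma> ^^ n) -` B \<in> sets S"
    unfolding Bn using B measurable_sets[OF comp[of n], of "{True}"] by (simp add: space_S)
  then have "measure N (B \<inter> (\<sigma> ^^ n) -` B) = measure M (\<phi> -` (B \<inter> (\<sigma> ^^ n) -` B) \<inter> space M)"
    by (rule meas)
  also have "\<phi> -` (B \<inter> (\<sigma> ^^ n) -` B) \<inter> space M = A \<inter> (T ^^ n) -` A"
    using sets.sets_into_space[OF A] by (auto simp: B_def \<sigma>n \<phi>_def)
  finally have 1: "measure N (B \<inter> (\<sigma> ^^ n) -` B) = measure M (A \<inter> (T ^^ n) -` A)" .
  have "\<phi> -` B \<inter> space M = A"
    using sets.sets_into_space[OF A] by (auto simp: B_def \<phi>_def)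
  then have "measure N B = measure M A"
    by (simp add: meas B)
  with n 1 show "\<exists>n\<in>R. measure M (A \<inter> (T ^^ n) -` A) \<ge> (measure M A)\<^sup>2 - \<epsilon>"
    by auto
qed

end

theory Submission
  imports Defs
begin

text \<open>It suffices to treat two sets \<open>P\<close> and \<open>Q\<close> whose union is a set of nice recurrence; the
  general case follows by induction on the number of sets.

  Suppose that neither is a set of nice recurrence, as witnessed by sets \<open>A\<close> for \<open>P\<close> and \<open>B\<close> for \<open>Q\<close>
  in two systems. The product set \<open>A \<times> B\<close> need not be a counterexample for \<open>P \<union> Q\<close>: at a time
  \<open>n \<in> P\<close> the set \<open>A\<close> loses a fixed proportion of the expected measure of its return, but nothing
  prevents \<open>B\<close> from returning to itself completely, and this gain may outweigh the loss. The
  combination of the two systems has to be negatively correlated at the times in \<open>P\<close> whatever the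
  second system does, and symmetrically.

  To achieve this, first make the loss almost total. In the \<open>m\<close>-th power of a system the set
  \<open>A\<^sup>m\<close> satisfies \<open>\<mu>(A\<^sup>m \<inter> T\<^sup>-\<^sup>n A\<^sup>m) / \<mu>(A\<^sup>m)\<^sup>2 = (\<mu>(A \<inter> T\<^sup>-\<^sup>n A) / \<mu>(A)\<^sup>2)\<^sup>m\<close>, which for large \<open>m\<close> is
  uniformly small on \<open>P\<close> (\<open>amplify_non_recurrence\<close>). The centred function
  \<open>f = 1\<^sub>A / \<mu>(A) - 1\<close> built from this power then has autocorrelations \<open>x\<^sub>n = \<integral> f \<cdot> f \<circ> T\<^sup>n\<close> close to \<open>-1\<close>
  for \<open>n \<in> P\<close>, while \<open>x\<^sub>n \<ge> -1\<close> for every \<open>n\<close>, simply because measures are nonnegative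
  (\<open>strongly_negative_observable\<close>). Similarly \<open>Q\<close> yields \<open>g\<close> with autocorrelations \<open>y\<^sub>n\<close>.

  Next, autocorrelations of centred functions add up when the functions are added on independent
  coordinates, and multiply when the functions are multiplied on independent coordinates. So every
  polynomial in \<open>x\<^sub>n\<close> and \<open>y\<^sub>n\<close> with nonnegative coefficients and no constant term is an
  autocorrelation of a centred function. The polynomial \<open>9x + 9y + 16xy\<close> is one of them. If
  \<open>x \<in> [-1, -9/16]\<close>, its slope \<open>9 + 16x\<close> in \<open>y\<close> is not positive, so among all \<open>y \<ge> -1\<close> it is largest at
  \<open>y = -1\<close>, where its value is \<open>-9 - 7x \<le> -2\<close>; no upper bound on \<open>y\<close> is involved
  (\<open>negative_combination\<close>). By symmetry, the resulting centred function has autocorrelations at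
  most \<open>-2\<close> at all times in \<open>P \<union> Q\<close>.

  This contradicts the nice recurrence of \<open>P \<union> Q\<close>, which passes from sets to bounded functions: a
  function with values in \<open>[0, 1]\<close> is replaced by the random set that contains each point
  independently, with the value of the function as its probability
  (\<open>nice_recurrence_unit_interval_function\<close>).\<close>

section \<open>Constructions of measure preserving systems\<close>

lemma measure_preserving_system_iff_distr:
  "measure_preserving_system M T \<longleftrightarrow> prob_space M \<and> T \<in> M \<rightarrow>\<^sub>M M \<and> distr M M T = M"
proof (intro iffI conjI)
  assume mps: "measure_preserving_system M T"
  interpret measure_preserving_system M T by (fact mps)
  show "prob_space M" by unfold_locales
  show T: "T \<in> M \<rightarrow>\<^sub>M M" by (fact measurable_T)
  show "distr M M T = M"
  proof (rule measure_eqI)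
    fix A assume "A \<in> sets (distr M M T)"
    then show "emeasure (distr M M T) A = emeasure M A"
      using T by (simp add: emeasure_distr emeasure_eq_measure measure_vimage_T)
  qed simp
next
  assume "prob_space M \<and> T \<in> M \<rightarrow>\<^sub>M M \<and> distr M M T = M"
  then have M: "prob_space M" and T: "T \<in> M \<rightarrow>\<^sub>M M" and d: "distr M M T = M" by auto
  have "measure M (T -` A \<inter> space M) = measure M A" if "A \<in> sets M" for A
    using measure_distr[OF T that] d by simp
  with M T show "measure_preserving_system M T"
    by (simp add: measure_preserving_system_def measure_preserving_system_axioms_def)
qed

lemma (in measure_preserving_system) measurable_funpow [measurable]: "T ^^ n \<in> M \<rightarrow>\<^sub>M M"
proof (induction n)
  case (Suc n)
  show ?case
    using measurable_comp[OF Suc measurable_T] by (simp add: o_def)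
qed (simp add: id_def)

lemma (in measure_preserving_system) integral_funpow:
  fixes f :: "'a \<Rightarrow> real"
  assumes f: "f \<in> borel_measurable M"
  shows "(\<integral>x. f ((T ^^ n) x) \<partial>M) = (\<integral>x. f x \<partial>M)"
proof (induction n)
  case (Suc n)
  have "distr M M T = M"
    using measure_preserving_system_axioms by (simp add: measure_preserving_system_iff_distr)
  moreover have "(\<lambda>x. f ((T ^^ n) x)) \<in> borel_measurable M"
    using f measurable_funpow by (rule measurable_compose[rotated])
  ultimately have "(\<integral>x. f ((T ^^ n) (T x)) \<partial>M) = (\<integral>x. f ((T ^^ n) x) \<partial>M)"
    using integral_distr[OF measurable_T, of "\<lambda>x. f ((T ^^ n) x)"] by simp
  with Suc show ?case
    by (simp add: funpow_swap1)
qed simp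

lemma funpow_map_prod:
  fixes T :: "'a \<Rightarrow> 'a" and S :: "'b \<Rightarrow> 'b"
  shows "map_prod T S ^^ n = map_prod (T ^^ n) (S ^^ n)"
  by (induction n) (auto simp: fun_eq_iff)

lemma measure_preserving_system_pair:
  assumes "measure_preserving_system M T" "measure_preserving_system N S"
  shows "measure_preserving_system (M \<Otimes>\<^sub>M N) (map_prod T S)"
proof -
  interpret M: measure_preserving_system M T by fact
  interpret N: measure_preserving_system N S by fact
  interpret P: pair_prob_space M N ..
  note M.measurable_T [measurable] N.measurable_T [measurable]
  have d: "distr M M T = M" "distr N N S = N"
    using assms by (simp_all add: measure_preserving_system_iff_distr)
  have "distr M M T \<Otimes>\<^sub>M distr N N S = distr (M \<Otimes>\<^sub>M N) (M \<Otimes>\<^sub>M N) (\<lambda>(x, y). (T x, S y))"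
    by (rule pair_measure_distr) (simp_all add: d N.sigma_finite_measure_axioms M.measurable_T N.measurable_T)
  then have "distr (M \<Otimes>\<^sub>M N) (M \<Otimes>\<^sub>M N) (map_prod T S) = M \<Otimes>\<^sub>M N"
    by (simp add: d map_prod_def)
  moreover have "map_prod T S \<in> M \<Otimes>\<^sub>M N \<rightarrow>\<^sub>M M \<Otimes>\<^sub>M N"
    unfolding map_prod_def by measurable
  ultimately show ?thesis
    by (simp add: measure_preserving_system_iff_distr P.prob_space_axioms)
qed

lemma measure_preserving_system_finite_power:
  assumes "measure_preserving_system M T" "finite I"
  shows "measure_preserving_system (PiM I (\<lambda>_. M)) (compose I T)"
proof -
  interpret measure_preserving_system M T by fact
  note measurable_T [measurable]
  have "distr (PiM I (\<lambda>_. M)) (PiM I (\<lambda>_. M)) (compose I T) = PiM I (\<lambda>_. distr M M T)"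
    by (rule distr_PiM_finite_prob_space') (use assms in \<open>simp_all add: prob_space_axioms\<close>)
  moreover have "distr M M T = M"
    using assms by (simp add: measure_preserving_system_iff_distr)
  moreover have "compose I T \<in> PiM I (\<lambda>_. M) \<rightarrow>\<^sub>M PiM I (\<lambda>_. M)"
    unfolding compose_def by measurable
  ultimately show ?thesis
    by (simp add: measure_preserving_system_iff_distr prob_space_PiM prob_space_axioms)
qed

lemma measure_preserving_system_shift:
  assumes "prob_space M"
  shows "measure_preserving_system (PiM (UNIV :: nat set) (\<lambda>_. M)) (\<lambda>\<omega> k. \<omega> (Suc k))"
proof -
  have "(\<lambda>\<omega> k. \<omega> (Suc k)) \<in> PiM UNIV (\<lambda>_. M) \<rightarrow>\<^sub>M PiM (UNIV :: nat set) (\<lambda>_. M)"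
    by (rule measurable_PiM_single') (auto simp: space_PiM)
  then show ?thesis
    using distr_PiM_reindex[of UNIV "\<lambda>_. M" Suc "UNIV :: nat set"] assms
    by (simp add: measure_preserving_system_iff_distr prob_space_PiM restrict_def)
qed

lemma funpow_shift: "((\<lambda>\<omega> k. \<omega> (Suc k)) ^^ n) \<omega> k = \<omega> (n + k)"
  by (induction n arbitrary: k) auto

section \<open>Autocorrelations of bounded functions\<close>

definition bounded_observable :: "'a measure \<Rightarrow> ('a \<Rightarrow> real) \<Rightarrow> bool" where
  "bounded_observable M f \<longleftrightarrow> f \<in> borel_measurable M \<and> (\<exists>c. \<forall>x\<in>space M. \<bar>f x\<bar> \<le> c)"

definition centred_observable :: "'a measure \<Rightarrow> ('a \<Rightarrow> real) \<Rightarrow> bool" where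
  "centred_observable M f \<longleftrightarrow> bounded_observable M f \<and> (\<integral>x. f x \<partial>M) = 0"

definition autocorrelation :: "'a measure \<Rightarrow> ('a \<Rightarrow> 'a) \<Rightarrow> ('a \<Rightarrow> real) \<Rightarrow> nat \<Rightarrow> real" where
  "autocorrelation M T f n = (\<integral>x. f x * f ((T ^^ n) x) \<partial>M)"

lemma (in finite_measure) integrable_bounded_observable:
  "bounded_observable M f \<Longrightarrow> integrable M f"
  unfolding bounded_observable_def
  by (metis AE_I2 integrable_const_bound real_norm_def)

lemma bounded_observable_mult:
  assumes "bounded_observable M f" "bounded_observable M g"
  shows "bounded_observable M (\<lambda>x. f x * g x)"
proof -
  from assms obtain c d where "\<And>x. x \<in> space M \<Longrightarrow> \<bar>f x\<bar> \<le> c" "\<And>x. x \<in> space M \<Longrightarrow> \<bar>g x\<bar> \<le> d"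
    unfolding bounded_observable_def by blast
  then have "\<bar>f x * g x\<bar> \<le> c * d" if "x \<in> space M" for x
    using that by (fastforce simp: abs_mult intro!: mult_mono)
  with assms show ?thesis
    unfolding bounded_observable_def by auto
qed

lemma bounded_observable_add:
  assumes "bounded_observable M f" "bounded_observable M g"
  shows "bounded_observable M (\<lambda>x. f x + g x)"
proof -
  from assms obtain c d where "\<And>x. x \<in> space M \<Longrightarrow> \<bar>f x\<bar> \<le> c" "\<And>x. x \<in> space M \<Longrightarrow> \<bar>g x\<bar> \<le> d"
    unfolding bounded_observable_def by blast
  then have "\<bar>f x + g x\<bar> \<le> c + d" if "x \<in> space M" for x
    using that by (meson abs_triangle_ineq add_mono order_trans)
  with assms show ?thesis
    unfolding bounded_observable_def by auto
qed

lemma bounded_observable_const: "bounded_observable M (\<lambda>_. c)"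
  unfolding bounded_observable_def by auto

lemma bounded_observable_compose:
  assumes "bounded_observable N f" "T \<in> M \<rightarrow>\<^sub>M N"
  shows "bounded_observable M (\<lambda>x. f (T x))"
  using assms measurable_compose[OF assms(2)] measurable_space[OF assms(2)]
  unfolding bounded_observable_def by fast

lemma integral_prod_of_factors:
  assumes "prob_space M" "prob_space N" "bounded_observable M f" "bounded_observable N g"
  shows "(\<integral>z. f (fst z) * g (snd z) \<partial>(M \<Otimes>\<^sub>M N)) = (\<integral>x. f x \<partial>M) * (\<integral>y. g y \<partial>N)"
proof -
  interpret M: prob_space M by fact
  interpret N: prob_space N by fact
  interpret P: pair_prob_space M N ..
  have "bounded_observable (M \<Otimes>\<^sub>M N) (\<lambda>z. f (fst z) * g (snd z))"
    by (intro bounded_observable_mult bounded_observable_compose[OF assms(3)]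
        bounded_observable_compose[OF assms(4)]) auto
  then have "integrable (M \<Otimes>\<^sub>M N) (\<lambda>z. f (fst z) * g (snd z))"
    by (rule P.P.integrable_bounded_observable)
  from P.integral_fst'[OF this] show ?thesis by simp
qed

lemma autocorrelation_tensor:
  assumes "measure_preserving_system M T" "measure_preserving_system N S"
    and "bounded_observable M f" "bounded_observable N g"
  shows "autocorrelation (M \<Otimes>\<^sub>M N) (map_prod T S) (\<lambda>z. f (fst z) * g (snd z)) n =
    autocorrelation M T f n * autocorrelation N S g n"
proof -
  interpret M: measure_preserving_system M T by fact
  interpret N: measure_preserving_system N S by fact
  have "bounded_observable M (\<lambda>x. f x * f ((T ^^ n) x))" "bounded_observable N (\<lambda>x. g x * g ((S ^^ n) x))"
    by (intro bounded_observable_mult bounded_observable_compose[OF assms(3)]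
        bounded_observable_compose[OF assms(4)] assms M.measurable_funpow N.measurable_funpow)+
  from integral_prod_of_factors[OF M.prob_space_axioms N.prob_space_axioms this] show ?thesis
    by (simp add: autocorrelation_def funpow_map_prod mult_ac)
qed

lemma centred_observable_tensor:
  assumes "prob_space M" "prob_space N" "centred_observable M f" "bounded_observable N g"
  shows "centred_observable (M \<Otimes>\<^sub>M N) (\<lambda>z. f (fst z) * g (snd z))"
  using assms integral_prod_of_factors[of M N f g]
  unfolding centred_observable_def
  by (auto intro!: bounded_observable_mult bounded_observable_compose[where f = f and N = M]
      bounded_observable_compose[where f = g and N = N])

lemma centred_observable_direct_sum:
  assumes "prob_space M" "prob_space N" "centred_observable M f" "centred_observable N g"
  shows "centred_observable (M \<Otimes>\<^sub>M N) (\<lambda>z. f (fst z) + g (snd z))"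
proof -
  interpret M: prob_space M by fact
  interpret N: prob_space N by fact
  interpret P: pair_prob_space M N ..
  have f: "bounded_observable M f" "(\<integral>x. f x \<partial>M) = 0" and g: "bounded_observable N g" "(\<integral>x. g x \<partial>N) = 0"
    using assms by (auto simp: centred_observable_def)
  have bo: "bounded_observable (M \<Otimes>\<^sub>M N) (\<lambda>z. f (fst z))" "bounded_observable (M \<Otimes>\<^sub>M N) (\<lambda>z. g (snd z))"
    by (intro bounded_observable_compose[OF f(1)] bounded_observable_compose[OF g(1)]; simp)+
  have "(\<integral>z. f (fst z) + g (snd z) \<partial>(M \<Otimes>\<^sub>M N)) = 0"
    using integral_prod_of_factors[OF assms(1,2) f(1) bounded_observable_const, of 1]
      integral_prod_of_factors[OF assms(1,2) bounded_observable_const g(1), of 1] f(2) g(2)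
      bo[THEN P.P.integrable_bounded_observable] by simp
  then show ?thesis
    unfolding centred_observable_def by (simp add: bounded_observable_add bo)
qed

lemma centred_observable_scale:
  "centred_observable M f \<Longrightarrow> centred_observable M (\<lambda>x. c * f x)"
  unfolding centred_observable_def by (simp add: bounded_observable_mult bounded_observable_const)

lemma autocorrelation_scale:
  "autocorrelation M T (\<lambda>x. c * f x) n = c\<^sup>2 * autocorrelation M T f n"
  by (simp add: autocorrelation_def power2_eq_square mult_ac flip: integral_mult_right_zero)

text \<open>The mixed terms \<open>\<integral> f \<cdot> \<integral> g \<circ> S\<^sup>n\<close> and \<open>\<integral> f \<circ> T\<^sup>n \<cdot> \<integral> g\<close> vanish because both functions are
  centred.\<close>

lemma autocorrelation_direct_sum:
  assumes "measure_preserving_system M T" "measure_preserving_system N S"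
    and fg: "centred_observable M f" "centred_observable N g"
  shows "autocorrelation (M \<Otimes>\<^sub>M N) (map_prod T S) (\<lambda>z. f (fst z) + g (snd z)) n =
    autocorrelation M T f n + autocorrelation N S g n"
proof -
  interpret M: measure_preserving_system M T by fact
  interpret N: measure_preserving_system N S by fact
  interpret P: pair_prob_space M N ..
  have f: "bounded_observable M f" "(\<integral>x. f x \<partial>M) = 0"
    and g: "bounded_observable N g" "(\<integral>y. g y \<partial>N) = 0"
    using fg by (auto simp: centred_observable_def)
  note bo = bounded_observable_mult bounded_observable_compose[OF f(1)] bounded_observable_const
    bounded_observable_compose[OF g(1)] M.measurable_funpow N.measurable_funpow f g
  have int: "integrable (M \<Otimes>\<^sub>M N) (\<lambda>z. u (fst z) * v (snd z))"
    if "bounded_observable M u" "bounded_observable N v" for u v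
    by (intro P.P.integrable_bounded_observable bounded_observable_mult
        bounded_observable_compose[OF that(1)] bounded_observable_compose[OF that(2)]) auto
  note eq = integral_prod_of_factors[OF M.prob_space_axioms N.prob_space_axioms]
  let ?f' = "\<lambda>x. f ((T ^^ n) x)" and ?g' = "\<lambda>y. g ((S ^^ n) y)"
  have f': "bounded_observable M ?f'" "bounded_observable M (\<lambda>x. f x * ?f' x)"
    and g': "bounded_observable N ?g'" "bounded_observable N (\<lambda>y. g y * ?g' y)"
    by (intro bo)+
  \<comment> \<open>The constant factors \<open>1\<close> below make every term a product over the two coordinates.\<close>
  note one = bounded_observable_const[of _ 1]
  have "autocorrelation (M \<Otimes>\<^sub>M N) (map_prod T S) (\<lambda>z. f (fst z) + g (snd z)) n =
    (\<integral>z. (f (fst z) * ?f' (fst z)) * 1 + f (fst z) * ?g' (snd z)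
        + (?f' (fst z) * g (snd z) + 1 * (g (snd z) * ?g' (snd z))) \<partial>(M \<Otimes>\<^sub>M N))"
    unfolding autocorrelation_def by (simp add: funpow_map_prod algebra_simps)
  also have "\<dots> = autocorrelation M T f n * 1 + 0 * (\<integral>y. ?g' y \<partial>N)
      + ((\<integral>x. ?f' x \<partial>M) * 0 + 1 * autocorrelation N S g n)"
    using int[OF f'(2) one] int[OF f(1) g'(1)] int[OF f'(1) g(1)] int[OF one g'(2)]
      eq[OF f'(2) one] eq[OF f(1) g'(1)] eq[OF f'(1) g(1)] eq[OF one g'(2)]
    by (simp add: f(2) g(2) autocorrelation_def M.prob_space N.prob_space)
  finally show ?thesis by simp
qed


section \<open>Nice recurrence for functions\<close>

text \<open>Multiply the system with a shift on independent uniform variables \<open>\<omega>\<^sub>0, \<omega>\<^sub>1, \<dots>\<close> and apply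
  recurrence to the set \<open>C = {(x, \<omega>). \<omega>\<^sub>0 \<le> f x}\<close>. Its measure is \<open>\<integral> f\<close>. A point \<open>(x, \<omega>)\<close> of \<open>C\<close>
  returns to \<open>C\<close> at time \<open>n\<close> iff \<open>\<omega>\<^sub>n \<le> f (T\<^sup>n x)\<close>, so by the independence of \<open>\<omega>\<^sub>0\<close> and \<open>\<omega>\<^sub>n\<close> the
  returning points have measure \<open>\<integral> f \<cdot> f \<circ> T\<^sup>n\<close>. Independence needs \<open>n \<noteq> 0\<close>, which holds as
  times of recurrence are positive by definition.\<close>

lemma nice_recurrence_unit_interval_function:
  assumes R: "nice_recurrence R" and mps: "measure_preserving_system M T"
    and f [measurable]: "f \<in> borel_measurable M"
    and range: "\<And>x. x \<in> space M \<Longrightarrow> 0 \<le> f x \<and> f x \<le> 1"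
    and \<epsilon>: "\<epsilon> > 0"
  shows "\<exists>n\<in>R. autocorrelation M T f n \<ge> (\<integral>x. f x \<partial>M)\<^sup>2 - \<epsilon>"
proof -
  interpret measure_preserving_system M T by fact
  define U :: "real measure" where "U = uniform_measure lborel {0..1}"
  define \<Omega> where "\<Omega> = PiM (UNIV :: nat set) (\<lambda>_. U)"
  define \<sigma> :: "(nat \<Rightarrow> real) \<Rightarrow> nat \<Rightarrow> real" where "\<sigma> = (\<lambda>\<omega> k. \<omega> (Suc k))"
  define C where "C = {z \<in> space (M \<Otimes>\<^sub>M \<Omega>). snd z 0 \<le> f (fst z)}"
  have sets_U [measurable_cong]: "sets U = sets borel"
    by (simp add: U_def)
  have space_U: "space U = UNIV"
    by (simp add: U_def)
  interpret U: prob_space U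
    unfolding U_def by (rule prob_space_uniform_measure) auto
  have mps\<Omega>: "measure_preserving_system \<Omega> \<sigma>"
    unfolding \<Omega>_def \<sigma>_def by (rule measure_preserving_system_shift) (fact U.prob_space_axioms)
  interpret \<Omega>: measure_preserving_system \<Omega> \<sigma> by (fact mps\<Omega>)
  interpret P: pair_prob_space M \<Omega> ..
  interpret PU: product_prob_space "\<lambda>_. U" "UNIV :: nat set" ..
  have comp [measurable]: "(\<lambda>\<omega>. \<omega> k) \<in> borel_measurable \<Omega>" for k
    unfolding \<Omega>_def by measurable
  have space_\<Omega>: "space \<Omega> = UNIV"
    by (simp add: \<Omega>_def space_PiM space_U)
  have C [measurable]: "C \<in> sets (M \<Otimes>\<^sub>M \<Omega>)"
    unfolding C_def by measurable
  have U_le: "measure U {..a} = a" if "0 \<le> a" "a \<le> 1" for a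
  proof -
    have "{0..1} \<inter> {..a} = {0..a}" using that by auto
    then show ?thesis
      using that by (simp add: U_def measure_uniform_measure)
  qed
  have box1: "measure \<Omega> {\<omega>. \<omega> 0 \<le> a} = a" if "0 \<le> a" "a \<le> 1" for a
    using PU.emeasure_PiM_Collect_single[of 0 "{..a}"] that
    by (simp add: \<Omega>_def[symmetric] space_\<Omega> sets_U \<Omega>.emeasure_eq_measure U.emeasure_eq_measure U_le)
  have box2: "measure \<Omega> {\<omega>. \<omega> 0 \<le> a \<and> \<omega> n \<le> b} = a * b"
    if "0 \<le> a" "a \<le> 1" "0 \<le> b" "b \<le> 1" "n \<noteq> 0" for a b n
    using PU.emeasure_PiM_Collect[of "{0, n}" "\<lambda>k. if k = 0 then {..a} else {..b}"] that
    by (simp add: \<Omega>_def[symmetric] space_\<Omega> sets_U \<Omega>.emeasure_eq_measure U.emeasure_eq_measure U_le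
        flip: ennreal_mult)
  have fibre: "measure (M \<Otimes>\<^sub>M \<Omega>) D = (\<integral>x. measure \<Omega> (Pair x -` D) \<partial>M)"
    if D [measurable]: "D \<in> sets (M \<Otimes>\<^sub>M \<Omega>)" for D
  proof -
    have "measure (M \<Otimes>\<^sub>M \<Omega>) D = (\<integral>z. indicator D z \<partial>(M \<Otimes>\<^sub>M \<Omega>))"
      using D by simp
    also have "\<dots> = (\<integral>x. (\<integral>\<omega>. indicator D (x, \<omega>) \<partial>\<Omega>) \<partial>M)"
      by (rule P.integral_fst'[symmetric])
        (use D in \<open>simp add: P.P.emeasure_eq_measure\<close>)
    also have "(\<lambda>x. \<integral>\<omega>. indicator D (x, \<omega>) \<partial>\<Omega>) = (\<lambda>x. measure \<Omega> (Pair x -` D))"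
    proof
      fix x
      have "(\<lambda>\<omega>. indicator D (x, \<omega>) :: real) = indicator (Pair x -` D)"
        by (auto simp: indicator_def)
      then show "(\<integral>\<omega>. indicator D (x, \<omega>) \<partial>\<Omega>) = measure \<Omega> (Pair x -` D)"
        using sets_Pair1[OF D] by simp
    qed
    finally show ?thesis .
  qed
  have "\<exists>n\<in>R. measure (M \<Otimes>\<^sub>M \<Omega>) (C \<inter> (map_prod T \<sigma> ^^ n) -` C) \<ge> (measure (M \<Otimes>\<^sub>M \<Omega>) C)\<^sup>2 - \<epsilon>"
    using nice_recurrence_all_types[OF R, where 'a = "'a \<times> (nat \<Rightarrow> real)"]
      measure_preserving_system_pair[OF mps mps\<Omega>] C \<epsilon>
    unfolding nice_recurrence_on_def by blast
  then obtain n where n: "n \<in> R"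
    "measure (M \<Otimes>\<^sub>M \<Omega>) (C \<inter> (map_prod T \<sigma> ^^ n) -` C) \<ge> (measure (M \<Otimes>\<^sub>M \<Omega>) C)\<^sup>2 - \<epsilon>"
    by blast
  have "n \<noteq> 0"
    using R n(1) by (auto simp: nice_recurrence_def nice_recurrence_on_def)
  have return: "C \<inter> (map_prod T \<sigma> ^^ n) -` C =
    {z \<in> space (M \<Otimes>\<^sub>M \<Omega>). snd z 0 \<le> f (fst z) \<and> snd z n \<le> f ((T ^^ n) (fst z))}"
    using measurable_space[OF measurable_funpow, of _ n]
    by (auto simp: C_def space_pair_measure space_\<Omega> funpow_map_prod \<sigma>_def funpow_shift)
  then have return_sets: "C \<inter> (map_prod T \<sigma> ^^ n) -` C \<in> sets (M \<Otimes>\<^sub>M \<Omega>)"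
    by simp
  have "measure (M \<Otimes>\<^sub>M \<Omega>) C = (\<integral>x. f x \<partial>M)"
    unfolding fibre[OF C]
  proof (rule Bochner_Integration.integral_cong)
    fix x assume "x \<in> space M"
    then have "Pair x -` C = {\<omega>. \<omega> 0 \<le> f x}"
      by (auto simp: C_def space_pair_measure space_\<Omega>)
    then show "measure \<Omega> (Pair x -` C) = f x"
      using range[OF \<open>x \<in> space M\<close>] by (simp add: box1)
  qed simp
  moreover have "measure (M \<Otimes>\<^sub>M \<Omega>) (C \<inter> (map_prod T \<sigma> ^^ n) -` C) = autocorrelation M T f n"
    unfolding fibre[OF return_sets] autocorrelation_def
  proof (rule Bochner_Integration.integral_cong)
    fix x assume x: "x \<in> space M"
    then have "Pair x -` (C \<inter> (map_prod T \<sigma> ^^ n) -` C) =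
        {\<omega>. \<omega> 0 \<le> f x \<and> \<omega> n \<le> f ((T ^^ n) x)}"
      unfolding return by (auto simp: space_pair_measure space_\<Omega>)
    then show "measure \<Omega> (Pair x -` (C \<inter> (map_prod T \<sigma> ^^ n) -` C)) = f x * f ((T ^^ n) x)"
      using range[OF x] range[OF measurable_space[OF measurable_funpow x, of n]] \<open>n \<noteq> 0\<close>
      by (simp add: box2)
  qed simp
  ultimately show ?thesis
    using n by auto
qed

text \<open>The function is squeezed into the unit interval by an affine map; the mean \<open>1/2\<close> of the result
  contributes the same \<open>1/4\<close> to its autocorrelation and to its squared mean.\<close>

lemma nice_recurrence_centred_observable:
  assumes R: "nice_recurrence R" and mps: "measure_preserving_system M T"
    and centred: "centred_observable M f" and \<epsilon>: "\<epsilon> > 0"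
  shows "\<exists>n\<in>R. autocorrelation M T f n \<ge> - \<epsilon>"
proof -
  interpret measure_preserving_system M T by fact
  have f: "bounded_observable M f" "(\<integral>x. f x \<partial>M) = 0"
    using centred by (auto simp: centred_observable_def)
  obtain c0 where c0: "\<And>x. x \<in> space M \<Longrightarrow> \<bar>f x\<bar> \<le> c0" and [measurable]: "f \<in> borel_measurable M"
    using f(1) unfolding bounded_observable_def by blast
  \<comment> \<open>The maximum makes the bound positive, so that it can be divided by.\<close>
  define c where "c = max 1 c0"
  have c: "c > 0" "\<And>x. x \<in> space M \<Longrightarrow> \<bar>f x\<bar> \<le> c"
    using c0 by (force simp: c_def)+
  define h where "h = (\<lambda>x. 1 / 2 + f x / (2 * c))"
  have h: "h \<in> borel_measurable M"
    unfolding h_def by measurable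
  have h_range: "0 \<le> h x \<and> h x \<le> 1" if "x \<in> space M" for x
    using c(1) c(2)[OF that] by (simp add: h_def field_simps abs_le_iff)
  have int [simp]: "integrable M f"
    by (rule integrable_bounded_observable) (fact f)
  have mean: "(\<integral>x. h x \<partial>M) = 1 / 2"
    unfolding h_def by (simp add: f(2) prob_space)
  have "autocorrelation M T h n = 1 / 4 + autocorrelation M T f n / (4 * c\<^sup>2)" for n
  proof -
    have fn: "bounded_observable M (\<lambda>x. f ((T ^^ n) x))"
      by (rule bounded_observable_compose[OF f(1) measurable_funpow])
    have [simp]: "integrable M (\<lambda>x. f ((T ^^ n) x))" "integrable M (\<lambda>x. f x * f ((T ^^ n) x))"
      by (intro integrable_bounded_observable bounded_observable_mult f fn)+
    have "(\<integral>x. f ((T ^^ n) x) \<partial>M) = 0"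
      using integral_funpow[of f n] f by simp
    have "autocorrelation M T h n =
      (\<integral>x. 1 / 4 + f x / (4 * c) + f ((T ^^ n) x) / (4 * c) + f x * f ((T ^^ n) x) / (4 * c\<^sup>2) \<partial>M)"
      unfolding autocorrelation_def h_def by (simp add: algebra_simps power2_eq_square)
    then show ?thesis
      using \<open>(\<integral>x. f ((T ^^ n) x) \<partial>M) = 0\<close> by (simp add: f(2) prob_space autocorrelation_def)
  qed
  moreover obtain n where "n \<in> R" "autocorrelation M T h n \<ge> (1 / 2)\<^sup>2 - \<epsilon> / (4 * c\<^sup>2)"
    using nice_recurrence_unit_interval_function[OF R mps h h_range, of "\<epsilon> / (4 * c\<^sup>2)"] \<epsilon> c(1) mean
    by auto
  ultimately have "1 / 4 + autocorrelation M T f n / (4 * c\<^sup>2) \<ge> (1 / 2)\<^sup>2 - \<epsilon> / (4 * c\<^sup>2)"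
    by simp
  then have "- \<epsilon> / (4 * c\<^sup>2) \<le> autocorrelation M T f n / (4 * c\<^sup>2)"
    by (simp add: power_divide)
  then have "autocorrelation M T f n \<ge> - \<epsilon>"
    using c(1) by (simp only: divide_le_cancel) auto
  with \<open>n \<in> R\<close> show ?thesis by blast
qed

section \<open>Strongly negative autocorrelations from the failure of recurrence\<close>

text \<open>The ratio of \<open>\<mu>(A \<inter> T\<^sup>-\<^sup>n A)\<close> to \<open>\<mu>(A)\<^sup>2\<close> is at most some \<open>q < 1\<close> for all \<open>n \<in> R\<close>. Passing to the
  \<open>m\<close>-th power of the system and of \<open>A\<close> raises this ratio to its \<open>m\<close>-th power. As
  measures are nonnegative, the strict inequality at any time in \<open>R\<close> shows that \<open>A\<close> is not a null
  set.\<close>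

lemma amplify_non_recurrence:
  assumes R: "R \<subseteq> {1..}" "\<not> nice_recurrence R" "R \<noteq> {}" and \<delta>: "\<delta> > 0"
  obtains M :: "(nat \<Rightarrow> nat \<Rightarrow> bool) measure" and T A where
    "measure_preserving_system M T" "A \<in> sets M" "measure M A > 0"
    "\<And>n. n \<in> R \<Longrightarrow> measure M (A \<inter> (T ^^ n) -` A) \<le> \<delta> * (measure M A)\<^sup>2"
proof -
  obtain M :: "(nat \<Rightarrow> bool) measure" and T A \<epsilon> where
    mps: "measure_preserving_system M T" and A: "A \<in> sets M" and \<epsilon>: "\<epsilon> > 0" and
    less: "\<And>n. n \<in> R \<Longrightarrow> measure M (A \<inter> (T ^^ n) -` A) < (measure M A)\<^sup>2 - \<epsilon>"
    using R unfolding nice_recurrence_def nice_recurrence_on_def by (meson not_le)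
  interpret measure_preserving_system M T by fact
  define a where "a = measure M A"
  obtain n0 where "n0 \<in> R" using R by blast
  then have a\<epsilon>: "\<epsilon> < a\<^sup>2"
    using less[of n0] measure_nonneg[of M "A \<inter> (T ^^ n0) -` A"] unfolding a_def by linarith
  then have a: "a > 0"
    using \<epsilon> measure_nonneg[of M A] by (cases "a = 0") (auto simp: a_def less_le)
  define q where "q = 1 - \<epsilon> / a\<^sup>2"
  have q: "0 \<le> q" "q < 1"
    using a\<epsilon> a \<epsilon> by (auto simp: q_def)
  obtain m where m: "q ^ m < \<delta>"
    using real_arch_pow_inv[OF \<delta> q(2)] by blast
  let ?M = "PiM {..<m} (\<lambda>_. M)" and ?T = "compose {..<m} T" and ?A = "\<Pi>\<^sub>E i\<in>{..<m}. A"
  interpret PM: finite_product_prob_space "\<lambda>_. M" "{..<m}"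
    by unfold_locales auto
  have box: "measure ?M (\<Pi>\<^sub>E i\<in>{..<m}. B) = measure M B ^ m" if "B \<in> sets M" for B
    using PM.finite_measure_PiM_emb[of "\<lambda>_. B"] that by simp
  have pow: "(?T ^^ n) \<omega> = compose {..<m} (T ^^ n) \<omega>" if "\<omega> \<in> extensional {..<m}" for n \<omega>
  proof (induction n)
    case 0
    show ?case using that by (auto simp: compose_def extensional_def)
  qed (auto simp: compose_def)
  have "measure_preserving_system ?M ?T"
    using mps by (rule measure_preserving_system_finite_power) simp
  moreover have "?A \<in> sets ?M"
    using A by (intro sets_PiM_I_finite) auto
  moreover have "measure ?M ?A > 0"
    using a A by (simp add: box a_def)
  moreover have "measure ?M (?A \<inter> (?T ^^ n) -` ?A) \<le> \<delta> * (measure ?M ?A)\<^sup>2" if "n \<in> R" for n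
  proof -
    let ?B = "A \<inter> (T ^^ n) -` A"
    have "?B = A \<inter> ((T ^^ n) -` A \<inter> space M)"
      using sets.sets_into_space[OF A] by blast
    then have B: "?B \<in> sets M"
      using A measurable_sets[OF measurable_funpow A, of n] by auto
    have "?A \<inter> (?T ^^ n) -` ?A = (\<Pi>\<^sub>E i\<in>{..<m}. ?B)"
      by (auto simp: pow PiE_iff compose_def)
    then have "measure ?M (?A \<inter> (?T ^^ n) -` ?A) = measure M ?B ^ m"
      using box[OF B] by simp
    also have "\<dots> \<le> (q * a\<^sup>2) ^ m"
    proof (rule power_mono)
      have "q * a\<^sup>2 = a\<^sup>2 - \<epsilon>"
        using a by (simp add: q_def left_diff_distrib)
      then show "measure M ?B \<le> q * a\<^sup>2"
        using less[OF that] by (simp add: a_def)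
    qed simp
    also have "\<dots> = q ^ m * (a ^ m)\<^sup>2"
      by (simp add: power_mult_distrib mult.commute flip: power_mult)
    also have "\<dots> \<le> \<delta> * (a ^ m)\<^sup>2"
      using m by (intro mult_right_mono) auto
    finally show ?thesis
      using A by (simp add: box a_def)
  qed
  ultimately show thesis by (rule that)
qed

text \<open>For \<open>f = 1\<^sub>A / \<mu>(A) - 1\<close> the autocorrelation at time \<open>n\<close> is \<open>\<mu>(A \<inter> T\<^sup>-\<^sup>n A) / \<mu>(A)\<^sup>2 - 1\<close>. The
  bound \<open>-1\<close> at all times, also outside \<open>R\<close>, is what makes the combination with a second system
  possible.\<close>

lemma strongly_negative_observable:
  assumes "R \<subseteq> {1..}" "\<not> nice_recurrence R" "R \<noteq> {}" "\<delta> > 0"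
  obtains M :: "(nat \<Rightarrow> nat \<Rightarrow> bool) measure" and T f where
    "measure_preserving_system M T" "centred_observable M f"
    "\<And>n. autocorrelation M T f n \<ge> - 1"
    "\<And>n. n \<in> R \<Longrightarrow> autocorrelation M T f n \<le> - 1 + \<delta>"
proof -
  obtain M :: "(nat \<Rightarrow> nat \<Rightarrow> bool) measure" and T A where
    mps: "measure_preserving_system M T" and A: "A \<in> sets M" and pos: "measure M A > 0" and
    le: "\<And>n. n \<in> R \<Longrightarrow> measure M (A \<inter> (T ^^ n) -` A) \<le> \<delta> * (measure M A)\<^sup>2"
    using assms by (rule amplify_non_recurrence) blast
  interpret measure_preserving_system M T by fact
  define a where "a = measure M A"
  define f where "f = (\<lambda>x. indicator A x / a - 1 :: real)"
  have a: "a > 0" using pos by (simp add: a_def)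
  have "\<bar>f x\<bar> \<le> 1 / a + 1" for x
    using a by (auto simp: f_def indicator_def field_simps)
  then have bo: "bounded_observable M f"
    unfolding bounded_observable_def using A by (auto simp: f_def)
  have [simp]: "integrable M (indicat_real B)" if "B \<in> sets M" for B
    using that by (simp add: emeasure_eq_measure)
  have int_A: "(\<integral>x. indicator A x \<partial>M) = a"
    using A by (simp add: a_def)
  have mean: "(\<integral>x. f x \<partial>M) = 0"
    using A a int_A by (simp add: f_def prob_space)
  have corr: "autocorrelation M T f n = measure M (A \<inter> (T ^^ n) -` A) / a\<^sup>2 - 1" for n
  proof -
    let ?B = "(T ^^ n) -` A \<inter> space M"
    have B: "?B \<in> sets M"
      using measurable_funpow A by (rule measurable_sets)
    have "a = (\<integral>x. indicator A ((T ^^ n) x) \<partial>M)"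
      using integral_funpow[of "indicator A" n] A int_A by simp
    also have "(\<integral>x. indicator A ((T ^^ n) x) \<partial>M) = (\<integral>x. indicator ?B x \<partial>M)"
      by (rule Bochner_Integration.integral_cong) (auto simp: indicator_def)
    finally have int_B: "measure M ?B = a"
      using B by simp
    have AB: "A \<inter> (T ^^ n) -` A = A \<inter> ?B"
      using sets.sets_into_space[OF A] by blast
    have "autocorrelation M T f n =
      (\<integral>x. indicator (A \<inter> ?B) x / a\<^sup>2 - indicator A x / a - indicator ?B x / a + 1 \<partial>M)"
      unfolding autocorrelation_def f_def
    proof (rule Bochner_Integration.integral_cong)
      fix x assume "x \<in> space M"
      then have "indicator ?B x = (indicator A ((T ^^ n) x) :: real)"
        by (auto simp: indicator_def)
      then show "(indicator A x / a - 1) * (indicator A ((T ^^ n) x) / a - 1) =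
          indicator (A \<inter> ?B) x / a\<^sup>2 - indicator A x / a - indicator ?B x / a + 1"
        by (simp add: indicator_inter_arith power2_eq_square left_diff_distrib right_diff_distrib
            diff_divide_distrib)
    qed simp
    also have "\<dots> = measure M (A \<inter> ?B) / a\<^sup>2 - 1"
      using A B int_A int_B a by (simp add: prob_space)
    finally show ?thesis by (simp add: AB)
  qed
  have "autocorrelation M T f n \<ge> - 1" for n
    by (simp add: corr)
  moreover have "autocorrelation M T f n \<le> - 1 + \<delta>" if "n \<in> R" for n
    using le[OF that] a by (simp add: corr a_def field_simps)
  ultimately show thesis
    using mps bo mean that unfolding centred_observable_def by blast
qed

section \<open>Combining two systems\<close>

text \<open>The expression is affine in \<open>y\<close> with slope \<open>9 + 16 x \<le> 0\<close>, hence at most its value at \<open>y = - 1\<close>.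
  The coefficients are squares, so that they arise from scaling the functions by \<open>3\<close> and \<open>4\<close>.\<close>

lemma negative_combination:
  fixes x y :: real
  assumes "- 1 \<le> x" "- 1 \<le> y" "x \<le> - 9 / 16"
  shows "9 * (x + y) + 16 * (x * y) \<le> - 2"
proof -
  have "0 \<le> (- 9 - 16 * x) * (1 + y)"
    using assms by (intro mult_nonneg_nonneg) auto
  then show ?thesis
    using assms by (simp add: algebra_simps)
qed

text \<open>The function \<open>3 f(x) + 3 g(y) + 4 f(x') g(y')\<close> on two independent copies of the product of the
  systems of \<open>f\<close> and \<open>g\<close> has the autocorrelations of \<open>negative_combination\<close>. On separate
  copies the product term is independent of the linear terms, so that their autocorrelations add
  up.\<close>

lemma nice_recurrence_Un:
  assumes sub: "P \<union> Q \<subseteq> {1..}" and nice: "nice_recurrence (P \<union> Q)"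
  shows "nice_recurrence P \<or> nice_recurrence Q"
proof (rule ccontr)
  assume "\<not> ?thesis"
  then have neg: "\<not> nice_recurrence P" "\<not> nice_recurrence Q" by auto
  with nice have ne: "P \<noteq> {}" "Q \<noteq> {}" by auto
  obtain M :: "(nat \<Rightarrow> nat \<Rightarrow> bool) measure" and T f where
    M: "measure_preserving_system M T" and f: "centred_observable M f" and
    f_ge: "\<And>n. autocorrelation M T f n \<ge> - 1" and
    f_le: "\<And>n. n \<in> P \<Longrightarrow> autocorrelation M T f n \<le> - 1 + 7 / 16"
    using strongly_negative_observable[of P "7 / 16"] sub neg ne by auto
  obtain N :: "(nat \<Rightarrow> nat \<Rightarrow> bool) measure" and S g where
    N: "measure_preserving_system N S" and g: "centred_observable N g" and
    g_ge: "\<And>n. autocorrelation N S g n \<ge> - 1" and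
    g_le: "\<And>n. n \<in> Q \<Longrightarrow> autocorrelation N S g n \<le> - 1 + 7 / 16"
    using strongly_negative_observable[of Q "7 / 16"] sub neg ne by auto
  define K V where "K = M \<Otimes>\<^sub>M N" and "V = map_prod T S"
  define s where "s = (\<lambda>z. 3 * f (fst z) + 3 * g (snd z))"
  define t where "t = (\<lambda>z. 4 * (f (fst z) * g (snd z)))"
  have K: "measure_preserving_system K V"
    unfolding K_def V_def using M N by (rule measure_preserving_system_pair)
  have prob: "prob_space M" "prob_space N" "prob_space K"
    using M N K by (auto simp: measure_preserving_system_def)
  have bo: "bounded_observable M f" "bounded_observable N g"
    using f g by (auto simp: centred_observable_def)
  have s: "centred_observable K s"
    unfolding K_def s_def by (intro centred_observable_direct_sum centred_observable_scale f g prob)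
  have t: "centred_observable K t"
    unfolding K_def t_def by (intro centred_observable_tensor centred_observable_scale f bo prob)
  let ?F = "autocorrelation M T f" and ?G = "autocorrelation N S g"
  let ?h = "\<lambda>z. s (fst z) + t (snd z)"
  have h_corr: "autocorrelation (K \<Otimes>\<^sub>M K) (map_prod V V) ?h n = autocorrelation K V s n + autocorrelation K V t n" for n
    by (rule autocorrelation_direct_sum[OF K K s t])
  have s_corr: "autocorrelation K V s n = 3\<^sup>2 * ?F n + 3\<^sup>2 * ?G n" for n
    unfolding K_def V_def s_def
    by (subst autocorrelation_direct_sum[OF M N])
      (simp_all only: centred_observable_scale f g autocorrelation_scale)
  have t_corr: "autocorrelation K V t n = 4\<^sup>2 * (?F n * ?G n)" for n
    unfolding K_def V_def t_def
    by (simp only: autocorrelation_scale autocorrelation_tensor[OF M N bo])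
  have corr: "autocorrelation (K \<Otimes>\<^sub>M K) (map_prod V V) ?h n =
    9 * (?F n + ?G n) + 16 * (?F n * ?G n)" for n
    by (simp add: h_corr s_corr t_corr)
  obtain n where n: "n \<in> P \<union> Q" "autocorrelation (K \<Otimes>\<^sub>M K) (map_prod V V) ?h n \<ge> - 1"
    using nice_recurrence_centred_observable[OF nice measure_preserving_system_pair[OF K K]
        centred_observable_direct_sum[OF prob(3) prob(3) s t], of 1] by auto
  have "9 * (?F n + ?G n) + 16 * (?F n * ?G n) \<le> - 2"
    using n(1)
  proof
    assume "n \<in> P"
    then show ?thesis
      using negative_combination[of "?F n" "?G n"] f_ge[of n] g_ge[of n] f_le[of n] by simp
  next
    assume "n \<in> Q"
    then show ?thesis
      using negative_combination[of "?G n" "?F n"] f_ge[of n] g_ge[of n] g_le[of n]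
      by (simp add: add.commute mult.commute)
  qed
  with n(2) corr[of n] show False by simp
qed

theorem theorem1:
  fixes R :: "nat set" and r :: nat and S :: "nat \<Rightarrow> nat set"
  assumes "R \<subseteq> {1..}"
    and "r \<ge> 1"
    and "R = (\<Union>i\<in>{1..r}. S i)"
    and "nice_recurrence R"
  shows "\<exists>i\<in>{1..r}. nice_recurrence (S i)"
proof -
  have "\<exists>i\<in>{1..r}. nice_recurrence (S i)"
    if "(\<Union>i\<in>{1..r}. S i) \<subseteq> {1..}" "nice_recurrence (\<Union>i\<in>{1..r}. S i)"
    using \<open>r \<ge> 1\<close> that
  proof (induction r rule: dec_induct)
    case base
    then show ?case by simp
  next
    case (step m)
    have "(\<Union>i\<in>{1..Suc m}. S i) = (\<Union>i\<in>{1..m}. S i) \<union> S (Suc m)"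
      by (auto simp: atLeastAtMostSuc_conv)
    with step.prems have "nice_recurrence (\<Union>i\<in>{1..m}. S i) \<or> nice_recurrence (S (Suc m))"
      by (intro nice_recurrence_Un) simp_all
    with step show ?case by fastforce
  qed
  with assms show ?thesis by simp
qed

end
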